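(* Let $d\ge 1$ be an integer and let $\mathcal{A}=\mathcal{M}(d,\mathbb{H})$ be the real algebra of $d\times d$ matrices over the quaternions. Then every square root of $-\mathbf{1}$ in $\mathcal{A}$ is conjugate to $i\mathbf{1}$. Consequently the set of square roots of $-\mathbf{1}$ is a single conjugacy class; it is a connected submanifold of $\mathcal{A}$ of dimension $2d^2=\dim_{\mathbb{R}}(\mathcal{A})/2$. Moreover $\mathrm{Scal}(f)=0$ for every square root $f$ of $-\mathbf{1}$.
   Context: $\mathbb{H}$ is the real algebra generated by $i,j$ with $i^2=j^2=-1$, $ji=-ij$; $\mathbf{1}$ is the unit matrix. Two elements $f,g\in\mathcal{A}$ are conjugate if $g=a^{-1}fa$ for some invertible $a\in\mathcal{A}$. $\mathcal{A}$ carries its usual topology as a finite-dimensional real vector space. The center of $\mathcal{A}$ is $\mathrm{Z}(\mathcal{A})=\mathbb{R}\mathbf{1}$, and $\mathcal{A}=\mathrm{Z}(\mathcal{A})\oplus[\mathcal{A},\mathcal{A}]$, where $[\mathcal{A},\mathcal{A}]$ is the real span of all commutators $fg-gf$. The linear form $\mathrm{Scal}:\mathcal{A}\to\mathbb{R}$ is defined by: $\mathrm{Scal}(f)\mathbf{1}$ is the projection of $f$ onto $\mathrm{Z}(\mathcal{A})$ along $[\mathcal{A},\mathcal{A}]$. *)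

theory Defs
  imports "HOL-Analysis.Analysis"
begin

section \<open>Quaternions\<close>

text \<open>\<open>Quat a b c d\<close> stands for \<open>a + b i + c j + d ij\<close>.\<close>

datatype quat = Quat (qRe: real) (qI: real) (qJ: real) (qK: real)

lemma quat_eq_iff: "x = y \<longleftrightarrow> qRe x = qRe y \<and> qI x = qI y \<and> qJ x = qJ y \<and> qK x = qK y"
  by (cases x; cases y) simp

definition quat_i :: quat where "quat_i = Quat 0 1 0 0"
definition quat_j :: quat where "quat_j = Quat 0 0 1 0"

lemma quat_ij_sel [simp]:
  "qRe quat_i = 0" "qI quat_i = 1" "qJ quat_i = 0" "qK quat_i = 0"
  "qRe quat_j = 0" "qI quat_j = 0" "qJ quat_j = 1" "qK quat_j = 0"
  by (simp_all add: quat_i_def quat_j_def)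

instantiation quat :: ring_1
begin

definition "0 = Quat 0 0 0 0"
definition "1 = Quat 1 0 0 0"
definition "x + y = Quat (qRe x + qRe y) (qI x + qI y) (qJ x + qJ y) (qK x + qK y)"
definition "x - y = Quat (qRe x - qRe y) (qI x - qI y) (qJ x - qJ y) (qK x - qK y)"
definition "- x = Quat (- qRe x) (- qI x) (- qJ x) (- qK x)"
definition "x * y = Quat
  (qRe x * qRe y - qI x * qI y - qJ x * qJ y - qK x * qK y)
  (qRe x * qI y + qI x * qRe y + qJ x * qK y - qK x * qJ y)
  (qRe x * qJ y - qI x * qK y + qJ x * qRe y + qK x * qI y)
  (qRe x * qK y + qI x * qJ y - qJ x * qI y + qK x * qRe y)"

instance
  by standard
    (simp_all add: zero_quat_def one_quat_def plus_quat_def minus_quat_def uminus_quat_def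
      times_quat_def quat_eq_iff algebra_simps)

end

lemma quat_sel [simp]:
  "qRe 0 = 0" "qI 0 = 0" "qJ 0 = 0" "qK 0 = 0"
  "qRe 1 = 1" "qI 1 = 0" "qJ 1 = 0" "qK 1 = 0"
  "qRe (x + y) = qRe x + qRe y" "qI (x + y) = qI x + qI y"
  "qJ (x + y) = qJ x + qJ y" "qK (x + y) = qK x + qK y"
  "qRe (x - y) = qRe x - qRe y" "qI (x - y) = qI x - qI y"
  "qJ (x - y) = qJ x - qJ y" "qK (x - y) = qK x - qK y"
  "qRe (- x) = - qRe x" "qI (- x) = - qI x" "qJ (- x) = - qJ x" "qK (- x) = - qK x"
  "qRe (x * y) = qRe x * qRe y - qI x * qI y - qJ x * qJ y - qK x * qK y"
  "qI (x * y) = qRe x * qI y + qI x * qRe y + qJ x * qK y - qK x * qJ y"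
  "qJ (x * y) = qRe x * qJ y - qI x * qK y + qJ x * qRe y + qK x * qI y"
  "qK (x * y) = qRe x * qK y + qI x * qJ y - qJ x * qI y + qK x * qRe y"
  by (simp_all add: zero_quat_def one_quat_def plus_quat_def minus_quat_def uminus_quat_def
      times_quat_def)

instantiation quat :: real_algebra_1
begin

definition "r *\<^sub>R x = Quat (r * qRe x) (r * qI x) (r * qJ x) (r * qK x)"

instance
  by standard (simp_all add: scaleR_quat_def quat_eq_iff algebra_simps)

end

lemma quat_scaleR_sel [simp]:
  "qRe (r *\<^sub>R x) = r * qRe x" "qI (r *\<^sub>R x) = r * qI x"
  "qJ (r *\<^sub>R x) = r * qJ x" "qK (r *\<^sub>R x) = r * qK x"
  by (simp_all add: scaleR_quat_def)

instantiation quat :: real_inner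
begin

definition "inner x y = qRe x * qRe y + qI x * qI y + qJ x * qJ y + qK x * qK y"
definition "norm (x::quat) = sqrt (inner x x)"
definition "sgn (x::quat) = x /\<^sub>R norm x"
definition "dist (x::quat) y = norm (x - y)"
definition "(uniformity :: (quat \<times> quat) filter) =
  (INF e\<in>{0 <..}. principal {(x, y). dist x y < e})"
definition "open (U :: quat set) \<longleftrightarrow>
  (\<forall>x\<in>U. eventually (\<lambda>(x', y). x' = x \<longrightarrow> y \<in> U) uniformity)"

instance
proof
  fix x y z :: quat and r :: real and U :: "quat set"
  show "0 \<le> inner x x"
    by (simp add: inner_quat_def)
  show "inner x x = 0 \<longleftrightarrow> x = 0"
  proof
    assume "inner x x = 0"
    then have "(qRe x)\<^sup>2 + ((qI x)\<^sup>2 + ((qJ x)\<^sup>2 + (qK x)\<^sup>2)) = 0"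
      by (simp add: inner_quat_def power2_eq_square)
    then show "x = 0"
      by (simp only: quat_eq_iff quat_sel) (smt (verit) zero_le_power2 power2_eq_iff_nonneg zero_power2 zero_eq_power2)
  next
    assume "x = 0"
    then show "inner x x = 0"
      by (simp add: inner_quat_def)
  qed
  show "inner x y = inner y x"
    by (simp add: inner_quat_def mult.commute)
  show "inner (x + y) z = inner x z + inner y z" "inner (r *\<^sub>R x) y = r * inner x y"
    by (simp_all add: inner_quat_def algebra_simps)
  show "norm x = sqrt (inner x x)" "sgn x = x /\<^sub>R norm x" "dist x y = norm (x - y)"
    "(uniformity :: (quat \<times> quat) filter) = (INF e\<in>{0 <..}. principal {(x, y). dist x y < e})"
    "open U \<longleftrightarrow> (\<forall>x\<in>U. eventually (\<lambda>(x', y). x' = x \<longrightarrow> y \<in> U) uniformity)"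
    by (rule norm_quat_def sgn_quat_def dist_quat_def uniformity_quat_def open_quat_def)+
qed

end

instantiation quat :: euclidean_space
begin

definition "Basis = {1, quat_i, quat_j, quat_i * quat_j}"

instance
proof
  show "(Basis :: quat set) \<noteq> {}" "finite (Basis :: quat set)"
    by (simp_all add: Basis_quat_def)
  fix u v x :: quat
  show "inner u v = (if u = v then 1 else 0)" if "u \<in> Basis" "v \<in> Basis"
    using that unfolding Basis_quat_def inner_quat_def by (elim insertE emptyE) (simp_all add: quat_eq_iff)
  show "(\<forall>u\<in>Basis. inner x u = 0) \<longleftrightarrow> x = 0"
    by (simp add: Basis_quat_def inner_quat_def quat_eq_iff [of x])
qed

end

lemma DIM_quat [simp]: "DIM(quat) = 4"
  by (simp add: Basis_quat_def quat_eq_iff)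

lemma quat_generators:
  "quat_i * quat_i = - 1" "quat_j * quat_j = - 1" "quat_j * quat_i = - (quat_i * quat_j)"
  by (simp_all add: quat_eq_iff)

lemma quat_expand:
  "q = qRe q *\<^sub>R 1 + qI q *\<^sub>R quat_i + qJ q *\<^sub>R quat_j + qK q *\<^sub>R (quat_i * quat_j)"
  by (simp add: quat_eq_iff)


section \<open>The matrix algebra\<close>

definition sqrts_neg_one :: "(quat ^ 'n ^ 'n) set" where
  "sqrts_neg_one = {f. f ** f = - mat 1}"

definition conjugate :: "quat ^ 'n ^ 'n \<Rightarrow> quat ^ 'n ^ 'n \<Rightarrow> bool" where
  "conjugate f g \<longleftrightarrow> (\<exists>a. invertible a \<and> g = matrix_inv a ** f ** a)"

definition conjugacy_class :: "quat ^ 'n ^ 'n \<Rightarrow> (quat ^ 'n ^ 'n) set" where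
  "conjugacy_class f = {g. conjugate f g}"

definition alg_center :: "(quat ^ 'n ^ 'n) set" where
  "alg_center = {z. \<forall>x. z ** x = x ** z}"

definition commutator_space :: "(quat ^ 'n ^ 'n) set" where
  "commutator_space = span {f ** g - g ** f | f g. True}"

definition center_proj :: "quat ^ 'n ^ 'n \<Rightarrow> quat ^ 'n ^ 'n" where
  "center_proj f = (THE z. z \<in> alg_center \<and> f - z \<in> commutator_space)"

definition Scal :: "quat ^ 'n ^ 'n \<Rightarrow> real" where
  "Scal f = (THE s. s *\<^sub>R mat 1 = center_proj f)"


text \<open>The remaining facts of this section show that \<open>Scal\<close> is well defined: the center is
  \<open>\<real>1\<close>, and it is a direct complement of the commutator space.\<close>

definition munit :: "'n \<Rightarrow> 'n \<Rightarrow> quat \<Rightarrow> quat ^ 'n ^ 'n" where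
  "munit a b q = (\<chi> i j. if i = a \<and> j = b then q else 0)"

definition retrace :: "quat ^ 'n ^ 'n \<Rightarrow> real" where
  "retrace f = (\<Sum>i\<in>UNIV. qRe (f $ i $ i))"

lemma mult_munit: "(f ** munit a b q) $ i $ j = (if j = b then f $ i $ a * q else 0)"
  by (simp add: matrix_matrix_mult_def munit_def if_distrib [of "\<lambda>x. y * x" for y] cong: if_cong)

lemma munit_mult: "(munit a b q ** f) $ i $ j = (if i = a then q * f $ b $ j else 0)"
  by (simp add: matrix_matrix_mult_def munit_def if_distrib [of "\<lambda>x. x * y" for y] cong: if_cong)

lemma munit_mult_munit: "munit a b p ** munit c d q = (if b = c then munit a d (p * q) else 0)"
  by (auto simp: vec_eq_iff munit_mult) (auto simp: munit_def)

lemma alg_center_eq: "(alg_center :: (quat ^ 'n ^ 'n) set) = range (\<lambda>s. s *\<^sub>R mat 1)"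
proof
  show "range (\<lambda>s. s *\<^sub>R mat 1) \<subseteq> (alg_center :: (quat ^ 'n ^ 'n) set)"
    by (auto simp: alg_center_def scalar_matrix_assoc [symmetric] matrix_scalar_ac)
next
  show "(alg_center :: (quat ^ 'n ^ 'n) set) \<subseteq> range (\<lambda>s. s *\<^sub>R mat 1)"
  proof
    fix z :: "quat ^ 'n ^ 'n"
    assume "z \<in> alg_center"
    then have z: "(z ** munit a b q) $ i $ j = (munit a b q ** z) $ i $ j" for a b q i j
      by (simp add: alg_center_def)
    have diag: "z $ a $ a * q = q * z $ b $ b" for a b q
      using z [of a b q a b] by (simp add: mult_munit munit_mult)
    have off: "z $ i $ a = 0" if "i \<noteq> a" for i a
      using z [of a a 1 i a] that by (simp add: mult_munit munit_mult)
    define a :: 'n where "a = undefined"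
    have "z $ a $ a = qRe (z $ a $ a) *\<^sub>R 1"
      using diag [of a quat_i a] diag [of a quat_j a] by (simp add: quat_eq_iff)
    moreover have "z $ b $ b = z $ a $ a" for b
      using diag [of a 1 b] by simp
    ultimately have "z = qRe (z $ a $ a) *\<^sub>R mat 1"
      by (auto simp: vec_eq_iff mat_def off)
    then show "z \<in> range (\<lambda>s. s *\<^sub>R mat 1)"
      by blast
  qed
qed

lemma retrace_linear: "linear retrace"
  by (rule linearI) (simp_all add: retrace_def sum.distrib sum_distrib_left)

lemma retrace_mult_commute: "retrace (f ** g) = retrace (g ** f)"
proof -
  have re_sum: "qRe (sum h A) = (\<Sum>k\<in>A. qRe (h k))" for h :: "'n \<Rightarrow> quat" and A
    by (induction A rule: infinite_finite_induct) auto
  have "retrace (f ** g) = (\<Sum>i\<in>UNIV. \<Sum>k\<in>UNIV. qRe (f $ i $ k * g $ k $ i))"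
    by (simp add: retrace_def matrix_matrix_mult_def re_sum del: quat_sel)
  also have "\<dots> = (\<Sum>k\<in>UNIV. \<Sum>i\<in>UNIV. qRe (f $ i $ k * g $ k $ i))"
    by (rule sum.swap)
  also have "\<dots> = (\<Sum>k\<in>UNIV. \<Sum>i\<in>UNIV. qRe (g $ k $ i * f $ i $ k))"
    by (simp add: algebra_simps)
  also have "\<dots> = retrace (g ** f)"
    by (simp add: retrace_def matrix_matrix_mult_def re_sum del: quat_sel)
  finally show ?thesis .
qed

lemma commutator_in_space: "f ** g - g ** f \<in> commutator_space"
  unfolding commutator_space_def by (rule span_base) blast

lemma subspace_commutator_space: "subspace commutator_space"
  unfolding commutator_space_def by (rule subspace_span)

lemma retrace_commutator_space:
  fixes f :: "quat ^ 'n ^ 'n"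
  assumes "f \<in> commutator_space"
  shows "retrace f = 0"
proof -
  have "commutator_space \<subseteq> {f :: quat ^ 'n ^ 'n. retrace f = 0}"
    unfolding commutator_space_def
  proof (rule span_minimal [OF _ linear_subspace_kernel [OF retrace_linear]])
    have "retrace (f ** g - g ** f) = 0" for f g :: "quat ^ 'n ^ 'n"
      using retrace_mult_commute [of f g] by (simp add: linear_diff [OF retrace_linear])
    then show "{f ** g - g ** f | f g. True} \<subseteq> {f :: quat ^ 'n ^ 'n. retrace f = 0}"
      by blast
  qed
  then show ?thesis using assms by blast
qed

lemma munit_off_commutator: "a \<noteq> b \<Longrightarrow> munit a b q \<in> commutator_space"
  using commutator_in_space [of "munit a a 1" "munit a b q"] by (simp add: munit_mult_munit)

lemma munit_bracket_commutator: "munit a a (p * q - q * p) \<in> commutator_space"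
proof -
  have "munit a a p ** munit a a q - munit a a q ** munit a a p = munit a a (p * q - q * p)"
    unfolding munit_mult_munit by (simp add: vec_eq_iff munit_def)
  then show ?thesis
    using commutator_in_space [of "munit a a p" "munit a a q"] by simp
qed

lemma munit_pure_commutator:
  assumes "qRe q = 0"
  shows "munit a a q \<in> commutator_space"
proof -
  let ?k = "quat_i * quat_j"
  have "q = (qI q / 2) *\<^sub>R (quat_j * ?k - ?k * quat_j) + (qJ q / 2) *\<^sub>R (?k * quat_i - quat_i * ?k)
      + (qK q / 2) *\<^sub>R (quat_i * quat_j - quat_j * quat_i)"
    using assms by (simp add: quat_eq_iff)
  then have "munit a a q = (qI q / 2) *\<^sub>R munit a a (quat_j * ?k - ?k * quat_j)
      + (qJ q / 2) *\<^sub>R munit a a (?k * quat_i - quat_i * ?k)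
      + (qK q / 2) *\<^sub>R munit a a (quat_i * quat_j - quat_j * quat_i)"
    by (simp add: vec_eq_iff munit_def)
  then show ?thesis
    by (metis munit_bracket_commutator subspace_add subspace_scale subspace_commutator_space)
qed

lemma munit_diff_commutator: "munit a a 1 - munit b b 1 \<in> commutator_space"
  using commutator_in_space [of "munit a b 1" "munit b a 1"] by (simp add: munit_mult_munit)

lemma commutator_space_eq: "commutator_space = {f :: quat ^ 'n ^ 'n. retrace f = 0}"
proof (intro equalityI subsetI)
  fix f :: "quat ^ 'n ^ 'n"
  assume "f \<in> {f. retrace f = 0}"
  then have tr: "(\<Sum>i\<in>UNIV. qRe (f $ i $ i)) = 0" by (simp add: retrace_def)
  define a :: 'n where "a = undefined"
  define pure where "pure q = q - qRe q *\<^sub>R 1" for q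
  let ?off = "\<lambda>i j. munit i j (if i = j then pure (f $ i $ i) else f $ i $ j)"
  let ?re = "\<lambda>i. qRe (f $ i $ i) *\<^sub>R (munit i i 1 - munit a a 1)"
  have "f = (\<Sum>i\<in>UNIV. \<Sum>j\<in>UNIV. ?off i j) + (\<Sum>i\<in>UNIV. ?re i)"
  proof -
    have s1: "(\<Sum>i\<in>UNIV. \<Sum>j\<in>UNIV. munit i j (h i j)) = (\<chi> i j. h i j)"
      for h :: "'n \<Rightarrow> 'n \<Rightarrow> quat"
    proof -
      have "(\<Sum>i\<in>UNIV. \<Sum>j\<in>UNIV. munit i j (h i j)) $ k $ l = h k l" for k l
      proof -
        have "(\<Sum>j\<in>UNIV. if k = i \<and> l = j then h i j else 0) = (if k = i then h i l else 0)" for i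
          by (cases "k = i") simp_all
        then have "(\<Sum>i\<in>UNIV. \<Sum>j\<in>UNIV. munit i j (h i j)) $ k $ l
            = (\<Sum>i\<in>UNIV. if k = i then h i l else 0)"
          by (simp add: munit_def)
        also have "\<dots> = h k l" by simp
        finally show ?thesis .
      qed
      then show ?thesis by (simp add: vec_eq_iff)
    qed
    have s2: "(\<Sum>i\<in>UNIV. qRe (f $ i $ i) *\<^sub>R munit i i 1) = (\<chi> i j. if i = j then qRe (f $ i $ i) *\<^sub>R 1 else 0)"
    proof -
      have "(\<Sum>i\<in>UNIV. qRe (f $ i $ i) *\<^sub>R munit i i 1) $ k $ l
          = (if k = l then qRe (f $ k $ k) *\<^sub>R 1 else 0)" for k l
      proof -
        have "(\<Sum>i\<in>UNIV. qRe (f $ i $ i) *\<^sub>R munit i i 1) $ k $ l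
            = (\<Sum>i\<in>UNIV. if k = i then (if k = l then qRe (f $ k $ k) *\<^sub>R 1 else 0) else 0)"
          unfolding sum_component by (rule sum.cong) (auto simp: munit_def)
        also have "\<dots> = (if k = l then qRe (f $ k $ k) *\<^sub>R 1 else 0)" by simp
        finally show ?thesis .
      qed
      then show ?thesis by (simp add: vec_eq_iff)
    qed
    have "(\<Sum>i\<in>UNIV. ?re i) = (\<Sum>i\<in>UNIV. qRe (f $ i $ i) *\<^sub>R munit i i 1)"
      using tr by (simp add: scaleR_diff_right sum_subtractf scaleR_left.sum [symmetric])
    then show ?thesis
      unfolding s1 s2 by (simp add: vec_eq_iff pure_def)
  qed
  moreover have "?off i j \<in> commutator_space" for i j
    by (simp add: munit_off_commutator munit_pure_commutator pure_def)
  moreover have "?re i \<in> commutator_space" for i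
    by (simp add: subspace_scale subspace_commutator_space munit_diff_commutator)
  ultimately show "f \<in> commutator_space"
    by (metis (no_types, lifting) subspace_add subspace_sum subspace_commutator_space)
qed (simp add: retrace_commutator_space)

lemma retrace_scalar: "retrace (s *\<^sub>R mat 1 :: quat ^ 'n ^ 'n) = s * real CARD('n)"
  by (simp add: retrace_def mat_def)

lemma center_proj_ex1: "\<exists>!z. z \<in> alg_center \<and> f - z \<in> commutator_space"
  for f :: "quat ^ 'n ^ 'n"
proof -
  have "s *\<^sub>R mat 1 \<in> alg_center \<and> f - s *\<^sub>R mat 1 \<in> commutator_space \<longleftrightarrow> s = retrace f / real CARD('n)"
    for s
    by (auto simp: alg_center_eq commutator_space_eq linear_diff [OF retrace_linear]
        retrace_scalar field_simps)
  then show ?thesis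
    unfolding alg_center_eq by (metis (no_types, lifting) imageE rangeI)
qed

lemma Scal_ex1: "\<exists>!s. s *\<^sub>R mat 1 = center_proj f" for f :: "quat ^ 'n ^ 'n"
proof -
  have "center_proj f \<in> alg_center"
    unfolding center_proj_def using theI' [OF center_proj_ex1] by blast
  moreover have "s = t" if "s *\<^sub>R mat 1 = (t *\<^sub>R mat 1 :: quat ^ 'n ^ 'n)" for s t
    using arg_cong [OF that, of retrace] by (simp add: retrace_scalar)
  ultimately show ?thesis
    unfolding alg_center_eq by (metis (no_types, lifting) imageE)
qed


section \<open>Smooth submanifolds of a Euclidean space\<close>

text \<open>On an open set of a finite-dimensional space, \<open>f\<close> is of class \<open>C\<^sup>n\<^sup>+\<^sup>1\<close> iff it is
  differentiable and all its directional derivatives are of class \<open>C\<^sup>n\<close>.\<close>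

primrec C_diff_on :: "nat \<Rightarrow> 'a::euclidean_space set \<Rightarrow> ('a \<Rightarrow> 'b::euclidean_space) \<Rightarrow> bool" where
  "C_diff_on 0 S f \<longleftrightarrow> continuous_on S f"
| "C_diff_on (Suc n) S f \<longleftrightarrow> (\<forall>x\<in>S. f differentiable (at x)) \<and>
     (\<forall>v. C_diff_on n S (\<lambda>x. frechet_derivative f (at x) v))"

definition smooth_on :: "'a::euclidean_space set \<Rightarrow> ('a \<Rightarrow> 'b::euclidean_space) \<Rightarrow> bool" where
  "smooth_on S f \<longleftrightarrow> (\<forall>n. C_diff_on n S f)"

definition diffeomorphism ::
  "'a::euclidean_space set \<Rightarrow> 'b::euclidean_space set \<Rightarrow> ('a \<Rightarrow> 'b) \<Rightarrow> ('b \<Rightarrow> 'a) \<Rightarrow> bool" where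
  "diffeomorphism U W \<phi> \<psi> \<longleftrightarrow> open U \<and> open W \<and>
     smooth_on U \<phi> \<and> smooth_on W \<psi> \<and> \<phi> ` U = W \<and> \<psi> ` W = U \<and>
     (\<forall>x\<in>U. \<psi> (\<phi> x) = x) \<and> (\<forall>y\<in>W. \<phi> (\<psi> y) = y)"

definition submanifold :: "nat \<Rightarrow> 'a::euclidean_space set \<Rightarrow> bool" where
  "submanifold k M \<longleftrightarrow> (\<forall>p\<in>M. \<exists>U W \<phi> \<psi> V. p \<in> U \<and> diffeomorphism U W \<phi> \<psi> \<and>
     subspace (V::'a set) \<and> dim V = k \<and> \<phi> ` (M \<inter> U) = V \<inter> W)"

end

(* Every vector v of H^n splits as a sum of right multiples of the vectors v - f v i and
   (v j) - f (v j) i, which satisfy f e = e i. A basis of such eigenvectors gives an invertible a with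
   f a = a i, so f is conjugate to i. Thus the square roots of -1 form the image of GL_n(H), which is
   connected because a hyperplane of H^n has real codimension four: columns of an invertible
   matrix can be exchanged for standard basis vectors along paths of invertible matrices. Near a
   square root p, the Cayley transform (1 + p f)(1 - p f)^(-1) maps the square roots to the linear
   space of matrices anticommuting with p, whose dimension is computed at p = i. Finally Scal
   is determined by the real trace, which is invariant under conjugation. *)

theory Submission
  imports Defs
begin

section \<open>Quaternionic linear algebra\<close>

lemma quat_inverse_exists:
  fixes q :: quat
  assumes "q \<noteq> 0"
  obtains r where "q * r = 1" "r * q = 1"
proof
  let ?n = "qRe q * qRe q + qI q * qI q + qJ q * qJ q + qK q * qK q"
  let ?r = "(1 / ?n) *\<^sub>R Quat (qRe q) (- qI q) (- qJ q) (- qK q)"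
  have "?n = inner q q"
    by (simp add: inner_quat_def)
  then have n: "?n \<noteq> 0"
    using assms by simp
  show "q * ?r = 1" "?r * q = 1"
    using n by (simp_all add: quat_eq_iff field_simps)
qed

text \<open>Matrices act from the left, so \<open>quat ^ 'n\<close> is treated as a right module:
  right multiplication by a quaternion commutes with every matrix, left multiplication in general
  does not.\<close>

definition right_scale :: "quat ^ 'n \<Rightarrow> quat \<Rightarrow> quat ^ 'n" where
  "right_scale v q = (\<chi> i. v $ i * q)"

lemma right_scale_nth [simp]: "right_scale v q $ i = v $ i * q"
  by (simp add: right_scale_def)

lemma right_scale_right_scale: "right_scale (right_scale v p) q = right_scale v (p * q)"
  by (simp add: vec_eq_iff mult.assoc)

lemma right_scale_one [simp]: "right_scale v 1 = v"
  by (simp add: vec_eq_iff)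

lemma matrix_vector_mult_right_scale:
  "a *v right_scale v q = right_scale (a *v v) q"
  by (simp add: vec_eq_iff matrix_vector_mult_def sum_distrib_right mult.assoc)

lemma matrix_vector_mult_axis: "(a *v axis k 1) $ i = (a :: quat ^ 'n ^ 'm) $ i $ k"
  by (simp add: matrix_vector_mult_def axis_def if_distrib [of "\<lambda>x. y * x" for y] cong: if_cong)

lemma matrix_eqI_axis:
  fixes a b :: "quat ^ 'n ^ 'm"
  assumes "\<And>k. a *v axis k 1 = b *v axis k 1"
  shows "a = b"
  by (metis assms matrix_vector_mult_axis vec_eq_iff)

lemma mat_vector_mult_nth: "(mat q *v v) $ i = (q :: quat) * v $ i"
  by (simp add: matrix_vector_mult_def mat_def if_distrib [of "\<lambda>x. x * y" for y] cong: if_cong)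

section \<open>The matrix product as a bounded bilinear map, and matrix inverses\<close>

lemma bilinear_matrix_mult: "bilinear ((**) :: quat ^ 'n ^ 'n \<Rightarrow> quat ^ 'n ^ 'n \<Rightarrow> quat ^ 'n ^ 'n)"
  unfolding bilinear_def
  by (auto intro!: linearI simp: matrix_add_ldistrib matrix_scalar_ac scalar_matrix_assoc)
    (simp add: matrix_matrix_mult_def vec_eq_iff sum.distrib distrib_right)

lemma bounded_bilinear_matrix_mult:
  "bounded_bilinear ((**) :: quat ^ 'n ^ 'n \<Rightarrow> quat ^ 'n ^ 'n \<Rightarrow> quat ^ 'n ^ 'n)"
  using bilinear_matrix_mult bilinear_conv_bounded_bilinear by blast

interpretation matrix_mult: bounded_bilinear
  "(**) :: quat ^ 'n ^ 'n \<Rightarrow> quat ^ 'n ^ 'n \<Rightarrow> quat ^ 'n ^ 'n"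
  by (rule bounded_bilinear_matrix_mult)

lemma matrix_inv_mult:
  fixes a :: "quat ^ 'n ^ 'n"
  assumes "invertible a"
  shows "matrix_inv a ** a = mat 1" "a ** matrix_inv a = mat 1"
  using assms someI_ex [of "\<lambda>b. a ** b = mat 1 \<and> b ** a = mat 1"]
  unfolding invertible_def matrix_inv_def by auto

lemma matrix_inv_unique_left:
  fixes a b :: "quat ^ 'n ^ 'n"
  assumes "invertible a" "b ** a = mat 1"
  shows "b = matrix_inv a"
  by (metis assms matrix_inv_mult(2) matrix_mul_assoc matrix_mul_lid matrix_mul_rid)

lemma invertible_matrix_inv:
  fixes a :: "quat ^ 'n ^ 'n"
  shows "invertible a \<Longrightarrow> invertible (matrix_inv a)"
  using matrix_inv_mult unfolding invertible_def by blast

text \<open>Over the noncommutative quaternions finite real dimension takes the place of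
  determinants: an injective real linear endomorphism is onto. Preimages of the
  \<open>axis k 1\<close> are the columns of a right inverse \<open>b\<close>, and cancelling the
  injective \<open>a\<close> in \<open>a ** b ** a = a\<close> makes \<open>b\<close> a left inverse
  too.\<close>

lemma invertible_iff_kernel_zero:
  fixes a :: "quat ^ 'n ^ 'n"
  shows "invertible a \<longleftrightarrow> (\<forall>v. a *v v = 0 \<longrightarrow> v = 0)"
proof
  assume "invertible a"
  then show "\<forall>v. a *v v = 0 \<longrightarrow> v = 0"
    by (metis invertible_def matrix_vector_mul_assoc matrix_vector_mul_lid matrix_vector_mult_0_right)
next
  assume ker: "\<forall>v. a *v v = 0 \<longrightarrow> v = 0"
  have inj: "inj ((*v) a)"
    using ker by (simp add: linear_injective_0 [OF matrix_vector_mul_linear])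
  then have "surj ((*v) a)"
    using linear_inj_imp_surj [OF matrix_vector_mul_linear] by blast
  then have "\<forall>k. \<exists>v. a *v v = axis k 1"
    by (metis surjD)
  then obtain g where g: "\<And>k. a *v g k = axis k 1"
    by metis
  define b where "b = (\<chi> i k. g k $ i)"
  have "b *v axis k 1 = g k" for k
    by (simp add: vec_eq_iff matrix_vector_mult_axis b_def)
  then have ab: "a ** b = mat 1"
    by (intro matrix_eqI_axis) (simp add: g flip: matrix_vector_mul_assoc)
  have "b ** a = mat 1"
  proof (rule matrix_eqI_axis)
    fix k
    have "a *v ((b ** a) *v axis k 1) = a *v (mat 1 *v axis k 1)"
      by (simp add: matrix_vector_mul_assoc matrix_mul_assoc ab)
    then show "(b ** a) *v axis k 1 = mat 1 *v axis k 1"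
      by (rule injD [OF inj])
  qed
  with ab show "invertible a"
    unfolding invertible_def by blast
qed

section \<open>Replacing one column of a matrix\<close>

definition set_col :: "quat ^ 'n ^ 'm \<Rightarrow> 'n \<Rightarrow> quat ^ 'm \<Rightarrow> quat ^ 'n ^ 'm" where
  "set_col a k w = (\<chi> i j. if j = k then w $ i else a $ i $ j)"

lemma set_col_axis: "set_col a k w *v axis j 1 = (if j = k then w else a *v axis j 1)"
  by (simp add: vec_eq_iff matrix_vector_mult_axis set_col_def)

text \<open>Once coordinate \<open>k\<close> of \<open>v\<close> is removed, the old column
  \<open>k\<close> no longer contributes, so the rest is computed by \<open>a\<close> and the new
  column enters as a separate right multiple.\<close>

lemma set_col_mult_vector:
  "set_col a k w *v v = a *v (v - axis k (v $ k)) + right_scale w (v $ k)"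
proof -
  have "(\<Sum>j\<in>UNIV. (if j = k then w $ i else a $ i $ j) * v $ j)
      = (\<Sum>j\<in>UNIV. a $ i $ j * (v - axis k (v $ k)) $ j + (if j = k then w $ i * v $ k else 0))" for i
    by (rule sum.cong) (auto simp: axis_def)
  then show ?thesis
    by (simp add: vec_eq_iff matrix_vector_mult_def set_col_def sum.distrib)
qed

section \<open>Conjugacy of the square roots\<close>

text \<open>Every vector is a combination \<open>v = (v - f v i) / 2 - ((v j) - f (v j) i) j / 2\<close>, so the
  eigenvectors \<open>f e = e i\<close> are not all contained in a proper right submodule. Columns
  can therefore be chosen greedily among them.\<close>

lemma sqrt_neg_one_eigenvector_outside:
  fixes f :: "quat ^ 'n ^ 'n"
  assumes f: "f ** f = - mat 1"
    and R: "subspace R" "\<And>v q. v \<in> R \<Longrightarrow> right_scale v q \<in> R" "R \<noteq> UNIV"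
  obtains e where "f *v e = right_scale e quat_i" "e \<notin> R"
proof -
  define w where "w v = v - right_scale (f *v v) quat_i" for v
  have ff: "f *v (f *v v) = - v" for v
  proof -
    have "f *v (f *v v) = (- mat 1) *v v"
      by (simp add: matrix_vector_mul_assoc f)
    also have "\<dots> = - (mat 1 *v v)"
      unfolding vec_eq_iff by (simp add: matrix_vector_mult_def sum_negf)
    finally show ?thesis by simp
  qed
  have eig: "f *v w v = right_scale (w v) quat_i" for v
  proof -
    have "f *v w v = f *v v + right_scale v quat_i"
      by (simp add: w_def matrix_vector_mult_diff_distrib matrix_vector_mult_right_scale ff vec_eq_iff)
    also have "\<dots> = right_scale (w v) quat_i"
      by (simp add: w_def vec_eq_iff left_diff_distrib mult.assoc quat_generators)
    finally show ?thesis .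
  qed
  obtain v where v: "v \<notin> R"
    using R by blast
  \<comment> \<open>Since \<open>j i j = i\<close>, the second term in the difference is
    \<open>- v - f v i\<close>, so the \<open>f v\<close> parts cancel and \<open>2 v\<close>
    remains.\<close>
  have "v = (1/2) *\<^sub>R (w v - right_scale (w (right_scale v quat_j)) quat_j)"
    by (simp add: w_def vec_eq_iff matrix_vector_mult_right_scale quat_eq_iff)
  moreover have "(1/2) *\<^sub>R (w v - right_scale (w (right_scale v quat_j)) quat_j) \<in> R"
    if "w v \<in> R" "w (right_scale v quat_j) \<in> R"
    using that R by (intro subspace_scale subspace_diff) auto
  ultimately show thesis
    using that eig v by metis
qed

text \<open>Induction over the set \<open>K\<close> of columns already chosen, starting from the
  zero matrix. The first clause makes every column an eigenvector; the kernel clause says that the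
  columns in \<open>K\<close> are right linearly independent. For \<open>K = UNIV\<close> this is
  injectivity.\<close>

lemma sqrt_neg_one_eigenmatrix:
  fixes f :: "quat ^ 'n ^ 'n"
  assumes f: "f ** f = - mat 1" and "finite (K :: 'n set)"
  shows "\<exists>a. f ** a = a ** mat quat_i \<and>
    (\<forall>v. (\<forall>j. j \<notin> K \<longrightarrow> v $ j = 0) \<longrightarrow> a *v v = 0 \<longrightarrow> v = 0)"
  using \<open>finite K\<close>
proof (induction K)
  case empty
  then show ?case
    by (intro exI [of _ 0]) (simp add: vec_eq_iff)
next
  case (insert k K)
  then obtain a :: "quat ^ 'n ^ 'n" where fa: "f ** a = a ** mat quat_i"
    and ker: "\<And>v. (\<forall>j. j \<notin> K \<longrightarrow> v $ j = 0) \<Longrightarrow> a *v v = 0 \<Longrightarrow> v = 0"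
    by blast
  define X where "X = {v :: quat ^ 'n. \<forall>j. j \<notin> K \<longrightarrow> v $ j = 0}"
  \<comment> \<open>The right submodule spanned by the columns in \<open>K\<close>; the next column
    has to avoid it.\<close>
  define R where "R = (*v) a ` X"
  have X: "subspace X"
    by (auto simp: X_def subspace_def)
  have R: "subspace R"
    unfolding R_def by (intro linear_subspace_image matrix_vector_mul_linear X)
  have Rs: "right_scale v q \<in> R" if "v \<in> R" for v q
    using that
    by (auto simp: R_def X_def matrix_vector_mult_right_scale [symmetric] intro!: imageI)
  \<comment> \<open>\<open>R\<close> is proper by counting real dimensions: \<open>X\<close> misses
    a vector, and its linear image \<open>R\<close> has no larger dimension.\<close>
  have "axis k 1 \<notin> X"
    using insert.hyps by (auto simp: X_def axis_def)
  then have "dim X < DIM(quat ^ 'n)"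
    using X dim_eq_full [of X] dim_subset_UNIV [of X] span_eq_iff [of X]
    by (metis UNIV_I le_neq_implies_less)
  moreover have "dim R \<le> dim X"
    unfolding R_def by (rule dim_image_le [OF matrix_vector_mul_linear])
  ultimately have "R \<noteq> UNIV"
    by auto
  then obtain e where fe: "f *v e = right_scale e quat_i" and e: "e \<notin> R"
    using sqrt_neg_one_eigenvector_outside [OF f R Rs] by blast
  have mi: "mat quat_i *v axis j 1 = right_scale (axis j 1) quat_i" for j :: 'n
    by (simp add: vec_eq_iff mat_vector_mult_nth axis_def)
  have "f ** set_col a k e = set_col a k e ** mat quat_i"
  proof (rule matrix_eqI_axis)
    fix j
    have "f *v (a *v axis j 1) = right_scale (a *v axis j 1) quat_i"
      by (simp add: matrix_vector_mul_assoc fa)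
        (simp add: mi matrix_vector_mult_right_scale flip: matrix_vector_mul_assoc)
    then show "(f ** set_col a k e) *v axis j 1 = (set_col a k e ** mat quat_i) *v axis j 1"
      by (simp add: mi matrix_vector_mult_right_scale set_col_axis fe flip: matrix_vector_mul_assoc)
  qed
  moreover have "v = 0" if supp: "\<forall>j. j \<notin> insert k K \<longrightarrow> v $ j = 0"
    and zero: "set_col a k e *v v = 0" for v
  proof -
    let ?u = "v - axis k (v $ k)"
    have u: "?u \<in> X"
      using supp by (auto simp: X_def axis_def)
    have eq: "a *v ?u + right_scale e (v $ k) = 0"
      using zero by (simp add: set_col_mult_vector)
    \<comment> \<open>Otherwise dividing on the right by this coordinate would put the new column
      \<open>e\<close> into \<open>R\<close>.\<close>
    have "v $ k = 0"
    proof (rule ccontr)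
      assume "v $ k \<noteq> 0"
      then obtain r where r: "v $ k * r = 1"
        using quat_inverse_exists by metis
      have "right_scale e (v $ k) = - (a *v ?u)"
        using eq by (simp add: eq_neg_iff_add_eq_0 add.commute)
      then have "right_scale e (v $ k) \<in> R"
        using u R by (auto simp: R_def intro: subspace_neg)
      then have "right_scale (right_scale e (v $ k)) r \<in> R"
        by (rule Rs)
      then show False
        using e by (simp add: right_scale_right_scale r)
    qed
    then have "?u = v" "a *v ?u = 0"
      using eq by (simp_all add: axis_def vec_eq_iff)
    then show "v = 0"
      using u ker [of ?u] by (metis (mono_tags, lifting) X_def mem_Collect_eq)
  qed
  ultimately show ?case
    by blast
qed

lemma sqrt_neg_one_conjugate:
  fixes f :: "quat ^ 'n ^ 'n"
  assumes "f \<in> sqrts_neg_one"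
  shows "conjugate f (mat quat_i)"
proof -
  \<comment> \<open>With all columns chosen, the support condition is vacuous.\<close>
  obtain a :: "quat ^ 'n ^ 'n" where a: "f ** a = a ** mat quat_i" "\<forall>v. a *v v = 0 \<longrightarrow> v = 0"
    using sqrt_neg_one_eigenmatrix [of f UNIV] assms by (auto simp: sqrts_neg_one_def)
  then have "invertible a"
    by (simp add: invertible_iff_kernel_zero)
  with a show ?thesis
    unfolding conjugate_def by (metis matrix_inv_mult(1) matrix_mul_assoc matrix_mul_lid)
qed

lemma mat_quat_i_sqrt: "(mat quat_i :: quat ^ 'n ^ 'n) \<in> sqrts_neg_one"
proof -
  have "(mat quat_i ** mat quat_i) *v axis k 1 = mat (- 1) *v axis k 1" for k :: 'n
    by (simp add: vec_eq_iff mat_vector_mult_nth mult.assoc [symmetric] quat_generators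
        flip: matrix_vector_mul_assoc)
  moreover have "mat (- 1) = (- mat 1 :: quat ^ 'n ^ 'n)"
    by (simp add: vec_eq_iff mat_def)
  ultimately have "mat quat_i ** mat quat_i = (- mat 1 :: quat ^ 'n ^ 'n)"
    by (metis matrix_eqI_axis)
  then show ?thesis
    by (simp add: sqrts_neg_one_def)
qed

text \<open>The orbit description of the roots, from which connectedness, the vanishing of
  \<open>Scal\<close> and the dimension of the charts are deduced.\<close>

lemma sqrts_neg_one_eq_image:
  "sqrts_neg_one = (\<lambda>a. a ** mat quat_i ** matrix_inv a) ` {a :: quat ^ 'n ^ 'n. invertible a}"
  (is "_ = ?C")
proof (intro equalityI subsetI)
  fix f :: "quat ^ 'n ^ 'n"
  assume "f \<in> sqrts_neg_one"
  then obtain a :: "quat ^ 'n ^ 'n" where a: "invertible a" "mat quat_i = matrix_inv a ** f ** a"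
    using sqrt_neg_one_conjugate [of f] unfolding conjugate_def by auto
  have "a ** mat quat_i ** matrix_inv a = (a ** matrix_inv a) ** f ** (a ** matrix_inv a)"
    unfolding a(2) by (simp only: matrix_mul_assoc)
  then have "f = a ** mat quat_i ** matrix_inv a"
    by (simp add: matrix_inv_mult [OF a(1)])
  with a(1) show "f \<in> ?C"
    by blast
next
  fix f :: "quat ^ 'n ^ 'n"
  assume "f \<in> ?C"
  then obtain a :: "quat ^ 'n ^ 'n" where a: "invertible a" "f = a ** mat quat_i ** matrix_inv a"
    by auto
  have "f ** f = a ** mat quat_i ** (matrix_inv a ** a) ** mat quat_i ** matrix_inv a"
    unfolding a(2) by (simp only: matrix_mul_assoc)
  also have "\<dots> = a ** (mat quat_i ** mat quat_i) ** matrix_inv a"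
    by (simp only: matrix_inv_mult [OF a(1)] matrix_mul_rid matrix_mul_assoc)
  also have "\<dots> = - mat 1"
    using a mat_quat_i_sqrt [where 'n = 'n]
    by (simp add: sqrts_neg_one_def matrix_mult.minus_left matrix_mult.minus_right matrix_inv_mult)
  finally show "f \<in> sqrts_neg_one"
    by (simp add: sqrts_neg_one_def)
qed

lemma conjugate_sym:
  fixes f g :: "quat ^ 'n ^ 'n"
  assumes "conjugate f g"
  shows "conjugate g f"
proof -
  obtain a :: "quat ^ 'n ^ 'n" where a: "invertible a" "g = matrix_inv a ** f ** a"
    using assms unfolding conjugate_def by blast
  have "matrix_inv (matrix_inv a) = a"
    by (metis a(1) invertible_matrix_inv matrix_inv_mult(2) matrix_inv_unique_left)
  moreover have "a ** g ** matrix_inv a = (a ** matrix_inv a) ** f ** (a ** matrix_inv a)"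
    unfolding a(2) by (simp only: matrix_mul_assoc)
  ultimately have "f = matrix_inv (matrix_inv a) ** g ** matrix_inv a"
    by (simp add: matrix_inv_mult [OF a(1)])
  then show ?thesis
    unfolding conjugate_def using a(1) invertible_matrix_inv by blast
qed

lemma sqrts_neg_one_eq_class: "(sqrts_neg_one :: (quat ^ 'n ^ 'n) set) = conjugacy_class (mat quat_i)"
proof (intro equalityI subsetI)
  show "f \<in> conjugacy_class (mat quat_i)" if "f \<in> sqrts_neg_one" for f :: "quat ^ 'n ^ 'n"
    using that by (simp add: conjugacy_class_def conjugate_sym sqrt_neg_one_conjugate)
  show "f \<in> sqrts_neg_one" if f: "f \<in> conjugacy_class (mat quat_i)" for f :: "quat ^ 'n ^ 'n"
  proof -
    obtain a :: "quat ^ 'n ^ 'n" where "invertible a" "mat quat_i = matrix_inv a ** f ** a"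
      using f conjugate_sym [of "mat quat_i" f] unfolding conjugacy_class_def conjugate_def by auto
    moreover have "f = (a ** matrix_inv a) ** f ** (a ** matrix_inv a)"
      using \<open>invertible a\<close> by (simp add: matrix_inv_mult)
    ultimately have "f = a ** mat quat_i ** matrix_inv a"
      by (simp add: matrix_mul_assoc)
    then show ?thesis
      using \<open>invertible a\<close> by (auto simp: sqrts_neg_one_eq_image)
  qed
qed

text \<open>Cyclicity of \<open>retrace\<close> reduces to \<open>mat quat_i\<close>, whose diagonal
  has real part zero. Vanishing trace means lying in the commutator space, so 0 is the central
  component.\<close>

lemma Scal_sqrt_neg_one:
  fixes f :: "quat ^ 'n ^ 'n"
  assumes "f \<in> sqrts_neg_one"
  shows "Scal f = 0"
proof -
  obtain a :: "quat ^ 'n ^ 'n" where a: "invertible a" "f = a ** mat quat_i ** matrix_inv a"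
    using assms unfolding sqrts_neg_one_eq_image by blast
  have "retrace f = retrace (matrix_inv a ** (a ** mat quat_i))"
    unfolding a(2) by (rule retrace_mult_commute)
  also have "\<dots> = retrace (mat quat_i :: quat ^ 'n ^ 'n)"
    by (simp add: matrix_mul_assoc matrix_inv_mult [OF a(1)])
  also have "\<dots> = 0"
    by (simp add: retrace_def mat_def)
  finally have "f \<in> commutator_space"
    by (simp add: commutator_space_eq)
  moreover have "0 \<in> alg_center"
    by (simp add: alg_center_def)
  ultimately have "center_proj f = 0"
    unfolding center_proj_def by (intro the1_equality [OF center_proj_ex1]) simp
  then show ?thesis
    unfolding Scal_def by (intro the1_equality [OF Scal_ex1]) simp
qed

section \<open>Connectedness of the general linear group\<close>

lemma invertible_near:
  fixes a :: "quat ^ 'n ^ 'n"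
  assumes "invertible a"
  obtains d M where "d > 0" "M > 0"
    "\<And>y. norm (y - a) < d \<Longrightarrow> invertible y \<and> norm (matrix_inv y) \<le> M"
proof -
  let ?b = "matrix_inv a"
  obtain K where K: "K > 0" "\<And>(x :: quat ^ 'n ^ 'n) (y :: quat ^ 'n ^ 'n). norm (x ** y) \<le> norm x * norm y * K"
    using matrix_mult.pos_bounded by blast
  \<comment> \<open>The summand 1 only secures \<open>c > 0\<close>.\<close>
  define c where "c = K * norm ?b + 1"
  have c: "c > 0" "K * norm ?b \<le> c"
    using K(1) by (auto simp: c_def intro: add_nonneg_pos)
  \<comment> \<open>\<open>?b ** (y ** x)\<close> differs from \<open>x\<close> by
    \<open>?b ** ((y - a) ** x)\<close>, and the radius is chosen so that this error is at most half
    of \<open>norm x\<close>. The resulting lower bound for \<open>y\<close> yields both its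
    injectivity and, at \<open>x = matrix_inv y\<close>, the bound on its inverse.\<close>
  have low: "norm x \<le> 2 * c * norm (y ** x)" if y: "norm (y - a) < 1 / (2 * K * c)"
    for x y :: "quat ^ 'n ^ 'n"
  proof -
    have "?b ** (y ** x) = x + ?b ** ((y - a) ** x)"
      by (simp add: matrix_mult.diff_left matrix_mult.diff_right matrix_mul_assoc matrix_inv_mult assms)
    then have "norm x \<le> norm (?b ** (y ** x)) + norm (?b ** ((y - a) ** x))"
      by (metis add_diff_cancel_right' norm_triangle_ineq4)
    also have "norm (?b ** (y ** x)) \<le> norm ?b * norm (y ** x) * K"
      by (rule K)
    also have "\<dots> \<le> c * norm (y ** x)"
      using mult_right_mono [OF c(2), of "norm (y ** x)"] by (simp add: mult_ac)
    also have "norm (?b ** ((y - a) ** x)) \<le> norm ?b * norm ((y - a) ** x) * K"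
      by (rule K)
    also have "\<dots> \<le> c * norm ((y - a) ** x)"
      using mult_right_mono [OF c(2), of "norm ((y - a) ** x)"] by (simp add: mult_ac)
    also have "\<dots> \<le> c * (norm (y - a) * norm x * K)"
      using c K by (intro mult_left_mono) auto
    also have "\<dots> = (c * K * norm (y - a)) * norm x"
      by (simp add: mult_ac)
    also have "\<dots> \<le> (1 / 2) * norm x"
      using y c K by (intro mult_right_mono) (auto simp: field_simps)
    finally show ?thesis
      by simp
  qed
  show thesis
  proof
    show "1 / (2 * K * c) > 0" "2 * c * norm (mat 1 :: quat ^ 'n ^ 'n) + 1 > 0"
      using c K by (auto intro!: add_nonneg_pos)
    fix y :: "quat ^ 'n ^ 'n"
    assume y: "norm (y - a) < 1 / (2 * K * c)"
    have "v = 0" if v: "y *v v = 0" for v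
    proof -
      \<comment> \<open>The vector is repeated in every column so that the matrix estimate
        \<open>low\<close> applies to it.\<close>
      define m :: "quat ^ 'n ^ 'n" where "m = (\<chi> i j. v $ i)"
      have "y ** m = 0"
        using v by (simp add: vec_eq_iff m_def matrix_matrix_mult_def matrix_vector_mult_def)
      then have "m = 0"
        using low [OF y, of m] by simp
      then show "v = 0"
        by (simp add: m_def vec_eq_iff)
    qed
    then have inv: "invertible y"
      by (simp add: invertible_iff_kernel_zero)
    then show "invertible y \<and> norm (matrix_inv y) \<le> 2 * c * norm (mat 1 :: quat ^ 'n ^ 'n) + 1"
      using low [OF y, of "matrix_inv y"] by (simp add: matrix_inv_mult)
  qed
qed

lemma open_invertible: "open {a :: quat ^ 'n ^ 'n. invertible a}"
  unfolding open_dist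
proof safe
  fix a :: "quat ^ 'n ^ 'n"
  assume "invertible a"
  then obtain d M where "d > 0" "\<And>y. norm (y - a) < d \<Longrightarrow> invertible y \<and> norm (matrix_inv y) \<le> M"
    using invertible_near by metis
  then show "\<exists>e>0. \<forall>y. dist y a < e \<longrightarrow> y \<in> {a. invertible a}"
    by (auto simp: dist_norm intro!: exI [of _ d])
qed

text \<open>With \<open>b\<close> the inverse of \<open>a\<close>,
  \<open>matrix_inv y - b = b (a - y) matrix_inv y\<close>. Using this identity twice, the remainder
  becomes \<open>b (a - y) (matrix_inv y - b)\<close>, which is quadratic in
  \<open>norm (y - a)\<close> because inverses near \<open>a\<close> are bounded by
  \<open>M\<close>; \<open>C\<close> collects the constants.\<close>

lemma has_derivative_matrix_inv:
  fixes a :: "quat ^ 'n ^ 'n"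
  assumes "invertible a"
  shows "(matrix_inv has_derivative (\<lambda>h. - (matrix_inv a ** h ** matrix_inv a))) (at a)"
proof -
  let ?b = "matrix_inv a"
  obtain K where K: "K > 0" "\<And>(x :: quat ^ 'n ^ 'n) (y :: quat ^ 'n ^ 'n). norm (x ** y) \<le> norm x * norm y * K"
    using matrix_mult.pos_bounded by blast
  have K3: "norm (x ** y ** z) \<le> K\<^sup>2 * norm x * norm y * norm z" for x y z :: "quat ^ 'n ^ 'n"
  proof -
    have "norm (x ** y ** z) \<le> norm (x ** y) * norm z * K"
      by (rule K)
    also have "\<dots> \<le> (norm x * norm y * K) * norm z * K"
      using K by (intro mult_right_mono) auto
    finally show ?thesis
      by (simp add: power2_eq_square mult_ac)
  qed
  obtain d M where d: "d > 0" "M > 0"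
    "\<And>y. norm (y - a) < d \<Longrightarrow> invertible y \<and> norm (matrix_inv y) \<le> M"
    using invertible_near [OF assms] by metis
  define C where "C = (K\<^sup>2 * norm ?b) * (K\<^sup>2 * norm ?b * M)"
  have lin: "bounded_linear (\<lambda>h. - (?b ** h ** ?b))"
    by (intro bounded_linear_minus matrix_mult.bounded_linear_left [THEN bounded_linear_compose]
        matrix_mult.bounded_linear_right)
  have bound: "norm (norm (matrix_inv y - ?b - - (?b ** (y - a) ** ?b)) / norm (y - a))
      \<le> C * norm (y - a)" if y: "norm (y - a) < d" for y
  proof -
    have inv: "invertible y"
      using d y by blast
    have "?b ** (a - y) ** matrix_inv y = (?b ** a) ** matrix_inv y - ?b ** (y ** matrix_inv y)"
      by (simp only: matrix_mult.diff_left matrix_mult.diff_right matrix_mul_assoc)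
    then have 1: "?b ** (a - y) ** matrix_inv y = matrix_inv y - ?b"
      by (simp add: matrix_inv_mult inv assms)
    have "matrix_inv y - ?b - - (?b ** (y - a) ** ?b) = ?b ** (a - y) ** matrix_inv y + ?b ** (y - a) ** ?b"
      by (simp add: 1)
    also have "\<dots> = ?b ** (a - y) ** (matrix_inv y - ?b)"
      by (simp add: matrix_mult.diff_left matrix_mult.diff_right)
    finally have 2: "matrix_inv y - ?b - - (?b ** (y - a) ** ?b) = ?b ** (a - y) ** (matrix_inv y - ?b)" .
    have "norm (matrix_inv y - ?b) \<le> K\<^sup>2 * norm ?b * norm (y - a) * norm (matrix_inv y)"
      using K3 [of ?b "a - y" "matrix_inv y"] by (simp add: 1 norm_minus_commute)
    also have "\<dots> \<le> K\<^sup>2 * norm ?b * norm (y - a) * M"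
      using d y by (intro mult_left_mono) auto
    finally have 3: "norm (matrix_inv y - ?b) \<le> K\<^sup>2 * norm ?b * norm (y - a) * M" .
    have "norm (?b ** (a - y) ** (matrix_inv y - ?b))
        \<le> K\<^sup>2 * norm ?b * norm (y - a) * norm (matrix_inv y - ?b)"
      using K3 [of ?b "a - y" "matrix_inv y - ?b"] by (simp add: norm_minus_commute)
    also have "\<dots> \<le> K\<^sup>2 * norm ?b * norm (y - a) * (K\<^sup>2 * norm ?b * norm (y - a) * M)"
      using 3 by (intro mult_left_mono) auto
    finally have "norm (?b ** (a - y) ** (matrix_inv y - ?b)) \<le> (C * norm (y - a)) * norm (y - a)"
      by (simp add: C_def mult_ac)
    then show ?thesis
      unfolding 2 by (cases "y = a") (simp_all add: pos_divide_le_eq)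
  qed
  have "((\<lambda>y. norm (matrix_inv y - ?b - - (?b ** (y - a) ** ?b)) / norm (y - a)) \<longlongrightarrow> 0) (at a)"
  proof (rule Lim_null_comparison)
    show "\<forall>\<^sub>F y in at a. norm (norm (matrix_inv y - ?b - - (?b ** (y - a) ** ?b)) / norm (y - a))
        \<le> C * norm (y - a)"
      unfolding eventually_at using bound d(1) by (intro exI [of _ d]) (auto simp: dist_norm)
    show "((\<lambda>y. C * norm (y - a)) \<longlongrightarrow> 0) (at a)"
      by (auto intro!: tendsto_eq_intros)
  qed
  then show ?thesis
    unfolding has_derivative_iff_norm using lin by blast
qed

lemma continuous_on_matrix_inv: "continuous_on {a :: quat ^ 'n ^ 'n. invertible a} matrix_inv"
  using has_derivative_matrix_inv
  by (intro continuous_at_imp_continuous_on) (auto dest: has_derivative_continuous)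

section \<open>Column replacement as right multiplication by elementary matrices\<close>

lemma set_col_mat_1_mult: "a ** set_col (mat 1) k c = set_col a k (a *v c)"
  by (rule matrix_eqI_axis) (simp add: set_col_axis flip: matrix_vector_mul_assoc)

lemma invertible_set_col_mat_1:
  assumes "c $ k \<noteq> 0"
  shows "invertible (set_col (mat 1) k c)"
  unfolding invertible_iff_kernel_zero
proof (intro allI impI)
  fix v
  assume "set_col (mat 1) k c *v v = 0"
  then have eq: "(v - axis k (v $ k)) $ i + c $ i * v $ k = 0" for i
    unfolding set_col_mult_vector vec_eq_iff by simp
  have "v $ k = 0"
  proof -
    obtain r where "r * c $ k = 1"
      using quat_inverse_exists [OF assms] by metis
    moreover have "c $ k * v $ k = 0"
      using eq [of k] by simp
    ultimately show ?thesis
      by (metis mult.assoc mult_1 mult_zero_right)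
  qed
  then have "v $ i = 0" for i
    using eq [of i] by (cases "i = k") (simp_all add: axis_def)
  then show "v = 0"
    by (simp add: vec_eq_iff)
qed

text \<open>Only coordinate \<open>k\<close> is constrained, and the nonzero quaternions are
  connected because their real dimension is at least two. The other coordinates are free, so the
  admissible columns are an image of a product of connected sets. Over the reals the analogous set
  would split by sign.\<close>

lemma connected_set_col_mat_1:
  "connected ((\<lambda>c. set_col (mat 1) k c) ` {c :: quat ^ 'n. c $ k \<noteq> 0})"
proof (rule connected_continuous_image)
  have "connected ((UNIV :: (quat ^ 'n) set) \<times> (- {0 :: quat}))"
    by (intro connected_Times connected_UNIV connected_punctured_universe) simp
  moreover have "continuous_on (UNIV \<times> - {0}) (\<lambda>(d :: quat ^ 'n, q). \<chi> j. if j = k then q else d $ j)"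
    unfolding case_prod_beta
  proof (intro continuous_on_vec_lambda)
    show "continuous_on (UNIV \<times> - {0}) (\<lambda>p :: (quat ^ 'n) \<times> quat. if j = k then snd p else fst p $ j)" for j
      by (cases "j = k") (auto intro!: continuous_intros)
  qed
  ultimately have "connected ((\<lambda>(d, q). \<chi> j. if j = k then q else d $ j) `
      ((UNIV :: (quat ^ 'n) set) \<times> (- {0 :: quat})))"
    by (intro connected_continuous_image)
  moreover have "(\<lambda>(d, q). \<chi> j. if j = k then q else d $ j) `
      ((UNIV :: (quat ^ 'n) set) \<times> (- {0 :: quat})) = {c. c $ k \<noteq> 0}" (is "?f ` ?A = _")
  proof (intro equalityI subsetI)
    fix c :: "quat ^ 'n"
    assume "c \<in> {c. c $ k \<noteq> 0}"
    then show "c \<in> ?f ` ?A"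
      by (intro image_eqI [where x = "(c, c $ k)"]) (auto simp: vec_eq_iff)
  qed auto
  ultimately show "connected {c :: quat ^ 'n. c $ k \<noteq> 0}"
    by simp
  show "continuous_on {c :: quat ^ 'n. c $ k \<noteq> 0} (\<lambda>c. set_col (mat 1) k c)"
    unfolding set_col_def
  proof (intro continuous_on_vec_lambda)
    show "continuous_on {c :: quat ^ 'n. c $ k \<noteq> 0} (\<lambda>c. if j = k then c $ i else mat 1 $ i $ j)" for i j
      by (cases "j = k") (auto intro!: continuous_intros)
  qed
qed

text \<open>Translating the connected family of elementary matrices by \<open>a\<close> keeps it
  among the invertible matrices; it passes through \<open>a\<close> at the column
  \<open>axis k 1\<close> and through the target at the column \<open>c\<close>.\<close>

lemma connected_component_set_col:
  fixes a :: "quat ^ 'n ^ 'n"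
  assumes "invertible a" "c $ k \<noteq> 0"
  shows "connected_component {a. invertible a} a (set_col a k (a *v c))"
proof -
  let ?S = "(\<lambda>c. set_col (mat 1) k c) ` {c :: quat ^ 'n. c $ k \<noteq> 0}"
  have "connected ((\<lambda>b. a ** b) ` ?S)"
    by (rule connected_continuous_image [OF _ connected_set_col_mat_1])
      (intro matrix_mult.continuous_on continuous_intros)
  moreover have "(\<lambda>b. a ** b) ` ?S \<subseteq> {a. invertible a}"
    using assms(1) by (auto intro!: invertible_mult invertible_set_col_mat_1)
  moreover have "a \<in> (\<lambda>b. a ** b) ` ?S"
  proof -
    have "a = a ** set_col (mat 1) k (axis k 1)"
      unfolding set_col_mat_1_mult by (rule matrix_eqI_axis) (simp add: set_col_axis)
    moreover have "set_col (mat 1) k (axis k 1) \<in> ?S"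
      by auto
    ultimately show ?thesis
      by blast
  qed
  moreover have "set_col a k (a *v c) \<in> (\<lambda>b. a ** b) ` ?S"
    using assms(2) by (auto simp flip: set_col_mat_1_mult)
  ultimately show ?thesis
    unfolding connected_component_def by blast
qed

text \<open>Gauss--Jordan elimination as a path: columns become standard basis vectors one after the
  other. When the coordinate needed for the exchange vanishes, another column not yet treated is
  first modified.\<close>

lemma invertible_connected_to_standard_columns:
  fixes a :: "quat ^ 'n ^ 'n"
  assumes "invertible a" "finite K"
  shows "\<exists>b. connected_component {a. invertible a} a b \<and> (\<forall>k\<in>K. b *v axis k 1 = axis k 1)"
  using assms(2)
proof (induction K)
  case empty
  then show ?case
    using assms(1) by (auto intro!: exI [of _ a] connected_component_refl)
next
  case (insert m K)
  then obtain b where ab: "connected_component {a. invertible a} a b"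
    and cols: "\<And>k. k \<in> K \<Longrightarrow> b *v axis k 1 = axis k 1"
    by blast
  \<comment> \<open>The direct exchange: possible when the preimage \<open>c\<close> of
    \<open>axis m 1\<close> has nonzero coordinate \<open>m\<close>.\<close>
  have exchange: ?case if e: "connected_component {a. invertible a} a e"
    and ecols: "\<And>k. k \<in> K \<Longrightarrow> e *v axis k 1 = axis k 1"
    and c: "e *v c = axis m 1" "c $ m \<noteq> 0" for e c
  proof -
    have "invertible e"
      using connected_component_in [OF e] by simp
    then have "connected_component {a. invertible a} e (set_col e m (axis m 1))"
      using connected_component_set_col [of e c m] c by simp
    then show ?thesis
      using e ecols insert.hyps
      by (intro exI [of _ "set_col e m (axis m 1)"])
        (auto simp: set_col_axis intro: connected_component_trans)
  qed
  have inv: "invertible b"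
    using connected_component_in [OF ab] by simp
  define c where "c = matrix_inv b *v axis m 1"
  have c: "b *v c = axis m 1"
    by (simp add: c_def matrix_vector_mul_assoc matrix_inv_mult inv)
  show ?case
  proof (cases "c $ m = 0")
    case False
    then show ?thesis
      using exchange ab cols c by blast
  next
    case True
    \<comment> \<open>If \<open>c\<close> were supported in \<open>K\<close>, where \<open>b\<close>
      has standard columns, then \<open>b\<close> would fix \<open>c\<close>, forcing
      \<open>c = axis m 1\<close> against \<open>c $ m = 0\<close>.\<close>
    have "\<exists>l. l \<notin> K \<and> c $ l \<noteq> 0"
    proof (rule ccontr)
      assume "\<not> ?thesis"
      then have supp: "c $ l = 0" if "l \<notin> K" for l
        using that by blast
      have "b $ i $ j * c $ j = mat 1 $ i $ j * c $ j" for i j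
      proof (cases "j \<in> K")
        case True
        then have "b *v axis j 1 = mat 1 *v axis j 1"
          by (simp add: cols)
        then show ?thesis
          by (metis matrix_vector_mult_axis)
      qed (simp add: supp)
      then have "b *v c = mat 1 *v c"
        by (simp add: vec_eq_iff matrix_vector_mult_def)
      then have "axis m 1 = c"
        by (simp add: c)
      then have "c $ m = 1"
        by (metis axis_nth)
      with True show False
        by simp
    qed
    then obtain l where l: "l \<notin> K" "c $ l \<noteq> 0"
      by blast
    with True have lm: "l \<noteq> m"
      by blast
    \<comment> \<open>Column \<open>m\<close> is added to column \<open>l\<close>. This leaves the
      columns in \<open>K\<close> alone and changes coordinate \<open>m\<close> of the preimage of
      \<open>axis m 1\<close> from 0 to \<open>- c $ l\<close>, so the direct exchange
      applies.\<close>
    define e where "e = set_col b l (b *v (axis l 1 + axis m 1))"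
    have "connected_component {a. invertible a} b e"
      unfolding e_def using lm by (intro connected_component_set_col inv) (simp add: axis_def)
    then have "connected_component {a. invertible a} a e"
      using ab connected_component_trans by metis
    moreover have "e *v axis k 1 = axis k 1" if "k \<in> K" for k
      using that l cols by (auto simp: e_def set_col_axis)
    moreover have "e *v (c - axis m (c $ l)) = axis m 1"
    proof -
      let ?u = "c - axis m (c $ l)"
      have ul: "?u $ l = c $ l"
        using lm by (simp add: axis_def)
      have "e *v ?u = b *v (?u - axis l (?u $ l)) + right_scale (b *v (axis l 1 + axis m 1)) (?u $ l)"
        unfolding e_def by (rule set_col_mult_vector)
      also have "\<dots> = b *v (?u - axis l (c $ l) + right_scale (axis l 1 + axis m 1) (c $ l))"
        by (simp only: ul matrix_vector_right_distrib matrix_vector_mult_right_scale)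
      also have "?u - axis l (c $ l) + right_scale (axis l 1 + axis m 1) (c $ l) = c"
        using lm by (auto simp: vec_eq_iff axis_def)
      finally show ?thesis
        by (simp add: c)
    qed
    moreover have "(c - axis m (c $ l)) $ m \<noteq> 0"
      using True l by simp
    ultimately show ?thesis
      using exchange by blast
  qed
qed

lemma connected_invertible: "connected {a :: quat ^ 'n ^ 'n. invertible a}"
proof -
  have "connected_component {a. invertible a} a (mat 1)" if a: "invertible a" for a :: "quat ^ 'n ^ 'n"
  proof -
    obtain b where b: "connected_component {a. invertible a} a b" "\<forall>k. b *v axis k 1 = axis k 1"
      using invertible_connected_to_standard_columns [OF a, of UNIV] by auto
    then have "b = mat 1"
      by (intro matrix_eqI_axis) simp
    with b show ?thesis
      by simp
  qed
  then show ?thesis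
    unfolding connected_iff_connected_component
    by (metis connected_component_sym connected_component_trans mem_Collect_eq)
qed

lemma connected_sqrts_neg_one: "connected (sqrts_neg_one :: (quat ^ 'n ^ 'n) set)"
  unfolding sqrts_neg_one_eq_image
  by (intro connected_continuous_image connected_invertible matrix_mult.continuous_on
      continuous_on_matrix_inv continuous_intros)

section \<open>Maps of class \<open>C\<^sup>n\<close>\<close>

text \<open>On an open set the derivative at a point depends only on values in the set, so the
  agreement passes to all derivatives by induction.\<close>

lemma C_diff_on_cong:
  assumes "open S" "\<And>x. x \<in> S \<Longrightarrow> f x = g x" "C_diff_on n S f"
  shows "C_diff_on n S g"
  using assms(2,3)
proof (induction n arbitrary: f g)
  case 0
  then show ?case
    using continuous_on_cong by (metis C_diff_on.simps(1))
next
  case (Suc n)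
  have deriv: "(g has_derivative frechet_derivative f (at x)) (at x)" if "x \<in> S" for x
  proof (rule has_derivative_transform_within_open)
    show "(f has_derivative frechet_derivative f (at x)) (at x)"
      using Suc.prems that by (simp add: frechet_derivative_works)
  qed (use assms(1) that Suc.prems in auto)
  then have "frechet_derivative g (at x) = frechet_derivative f (at x)" if "x \<in> S" for x
    using that frechet_derivative_at by metis
  then have "C_diff_on n S (\<lambda>x. frechet_derivative g (at x) v)" for v
    using Suc.IH [of "\<lambda>x. frechet_derivative f (at x) v"] Suc.prems by simp
  then show ?case
    using deriv by (auto simp: differentiable_def)
qed

text \<open>Derivatives are unique, so an explicit formula may stand in for
  \<open>frechet_derivative\<close>; the closure rules below are proved this way.\<close>

lemma C_diff_on_SucI:
  assumes "open S" "\<And>x. x \<in> S \<Longrightarrow> (f has_derivative f' x) (at x)"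
    and "\<And>v. C_diff_on n S (\<lambda>x. f' x v)"
  shows "C_diff_on (Suc n) S f"
proof -
  have "C_diff_on n S (\<lambda>x. frechet_derivative f (at x) v)" for v
    by (rule C_diff_on_cong [OF assms(1) _ assms(3) [of v]])
      (metis assms(2) frechet_derivative_at)
  then show ?thesis
    using assms(2) by (auto simp: differentiable_def)
qed

lemma C_diff_on_SucD:
  assumes "C_diff_on (Suc n) S f"
  shows "C_diff_on n S f"
  using assms
proof (induction n arbitrary: f)
  case 0
  then show ?case
    by (auto intro!: continuous_at_imp_continuous_on differentiable_imp_continuous_within)
qed simp

lemma C_diff_on_Suc_has_derivative:
  assumes "C_diff_on (Suc n) S f" "x \<in> S"
  shows "(f has_derivative frechet_derivative f (at x)) (at x)"
  using assms by (simp add: frechet_derivative_works)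

lemma C_diff_on_const: "open S \<Longrightarrow> C_diff_on n S (\<lambda>x. c)"
proof (induction n arbitrary: c)
  case (Suc n)
  then show ?case
    by (intro C_diff_on_SucI [of S _ "\<lambda>x v. 0"]) auto
qed simp

lemma C_diff_on_ident: "open S \<Longrightarrow> C_diff_on n S (\<lambda>x. x)"
proof (cases n)
  case (Suc m)
  then show "open S \<Longrightarrow> C_diff_on n S (\<lambda>x. x)"
    by (simp only:) (intro C_diff_on_SucI [of S _ "\<lambda>x v. v"] has_derivative_ident C_diff_on_const)
qed simp

lemma C_diff_on_add:
  assumes "open S" "C_diff_on n S f" "C_diff_on n S g"
  shows "C_diff_on n S (\<lambda>x. f x + g x)"
  using assms(2,3)
proof (induction n arbitrary: f g)
  case 0
  then show ?case
    by (simp add: continuous_on_add)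
next
  case (Suc n)
  show ?case
  proof (rule C_diff_on_SucI [OF assms(1)])
    show "((\<lambda>x. f x + g x) has_derivative
        (\<lambda>v. frechet_derivative f (at x) v + frechet_derivative g (at x) v)) (at x)" if "x \<in> S" for x
      using Suc.prems that by (intro has_derivative_add C_diff_on_Suc_has_derivative)
    show "C_diff_on n S (\<lambda>x. frechet_derivative f (at x) v + frechet_derivative g (at x) v)" for v
      using Suc.prems by (intro Suc.IH) simp_all
  qed
qed

lemma C_diff_on_bounded_linear:
  assumes "open S" "bounded_linear L" "C_diff_on n S f"
  shows "C_diff_on n S (\<lambda>x. L (f x))"
  using assms(3)
proof (induction n arbitrary: f)
  case 0
  then show ?case
    using assms(2) by (simp add: bounded_linear.continuous_on)
next
  case (Suc n)
  show ?case
  proof (rule C_diff_on_SucI [OF assms(1)])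
    show "((\<lambda>x. L (f x)) has_derivative (\<lambda>v. L (frechet_derivative f (at x) v))) (at x)"
      if "x \<in> S" for x
      using Suc.prems that
      by (intro bounded_linear.has_derivative [OF assms(2)] C_diff_on_Suc_has_derivative)
    show "C_diff_on n S (\<lambda>x. L (frechet_derivative f (at x) v))" for v
      using Suc.prems by (intro Suc.IH) simp_all
  qed
qed

text \<open>By the product rule each derivative is a sum of two products of the same kind. The
  induction therefore varies \<open>f\<close> and \<open>g\<close>, and the undifferentiated factor
  is lowered by one class.\<close>

lemma C_diff_on_bounded_bilinear:
  assumes "open S" "bounded_bilinear B" "C_diff_on n S f" "C_diff_on n S g"
  shows "C_diff_on n S (\<lambda>x. B (f x) (g x))"
  using assms(3,4)
proof (induction n arbitrary: f g)
  case 0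
  then show ?case
    using assms(2) by (simp add: bounded_bilinear.continuous_on)
next
  case (Suc n)
  show ?case
  proof (rule C_diff_on_SucI [OF assms(1)])
    show "((\<lambda>x. B (f x) (g x)) has_derivative
        (\<lambda>v. B (f x) (frechet_derivative g (at x) v) + B (frechet_derivative f (at x) v) (g x))) (at x)"
      if "x \<in> S" for x
      using Suc.prems that
      by (intro bounded_bilinear.FDERIV [OF assms(2)] C_diff_on_Suc_has_derivative)
    show "C_diff_on n S (\<lambda>x. B (f x) (frechet_derivative g (at x) v)
        + B (frechet_derivative f (at x) v) (g x))" for v
      using Suc.prems by (intro C_diff_on_add assms(1) Suc.IH) (auto intro: C_diff_on_SucD)
  qed
qed

lemma C_diff_on_diff:
  assumes "open S" "C_diff_on n S f" "C_diff_on n S g"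
  shows "C_diff_on n S (\<lambda>x. f x - g x)"
  using C_diff_on_add [OF assms(1,2) C_diff_on_bounded_linear
      [OF assms(1) bounded_linear_minus [OF bounded_linear_ident] assms(3)]]
  by simp

text \<open>Bootstrapping: the derivative is a product of the inverse itself with the derivative of
  \<open>g\<close>, so class \<open>n\<close> of the inverse, known by induction, gives class
  \<open>Suc n\<close>.\<close>

lemma C_diff_on_matrix_inv:
  fixes g :: "'a::euclidean_space \<Rightarrow> quat ^ 'n ^ 'n"
  assumes "open S" "C_diff_on n S g" "\<And>x. x \<in> S \<Longrightarrow> invertible (g x)"
  shows "C_diff_on n S (\<lambda>x. matrix_inv (g x))"
  using assms(2)
proof (induction n)
  case 0
  then show ?case
    using continuous_on_compose2 [OF continuous_on_matrix_inv, of S g] assms(3) by auto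
next
  case (Suc n)
  show ?case
  proof (rule C_diff_on_SucI [OF assms(1)])
    show "((\<lambda>x. matrix_inv (g x)) has_derivative
        (\<lambda>v. - (matrix_inv (g x) ** frechet_derivative g (at x) v ** matrix_inv (g x)))) (at x)"
      if "x \<in> S" for x
      by (rule has_derivative_compose
          [OF C_diff_on_Suc_has_derivative [OF Suc.prems that] has_derivative_matrix_inv [OF assms(3) [OF that]]])
    have "C_diff_on n S (\<lambda>x. matrix_inv (g x))"
      using Suc C_diff_on_SucD by blast
    then show "C_diff_on n S
        (\<lambda>x. - (matrix_inv (g x) ** frechet_derivative g (at x) v ** matrix_inv (g x)))" for v
      using Suc.prems
      by (intro C_diff_on_bounded_linear [OF assms(1) bounded_linear_minus [OF bounded_linear_ident]]
          C_diff_on_bounded_bilinear [OF assms(1) bounded_bilinear_matrix_mult]) simp_all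
  qed
qed

section \<open>Cayley charts\<close>

text \<open>Both Cayley maps are built from a doubled inverse; this undoes the doubling and the
  inversion when the maps are composed.\<close>

lemma matrix_inv_scaleR_matrix_inv:
  fixes a :: "quat ^ 'n ^ 'n"
  assumes "invertible a"
  shows "invertible (2 *\<^sub>R matrix_inv a)" "matrix_inv (2 *\<^sub>R matrix_inv a) = (1/2) *\<^sub>R a"
proof -
  have 1: "(2 *\<^sub>R matrix_inv a) ** ((1/2) *\<^sub>R a) = mat 1" "((1/2) *\<^sub>R a) ** (2 *\<^sub>R matrix_inv a) = mat 1"
    by (simp_all add: matrix_mult.scaleR_left matrix_mult.scaleR_right matrix_inv_mult assms)
  then show 2: "invertible (2 *\<^sub>R matrix_inv a)"
    unfolding invertible_def by blast
  show "matrix_inv (2 *\<^sub>R matrix_inv a) = (1/2) *\<^sub>R a"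
    using matrix_inv_unique_left [OF 2 1(2)] by simp
qed

text \<open>The kernel of the derivative of squaring at \<open>p\<close>; for a root
  \<open>p\<close> it serves as the linear model of the chart.\<close>

definition anticommutant :: "quat ^ 'n ^ 'n \<Rightarrow> (quat ^ 'n ^ 'n) set" where
  "anticommutant p = {h. p ** h + h ** p = 0}"

lemma subspace_anticommutant: "subspace (anticommutant p)"
proof -
  have "linear (\<lambda>h. p ** h + h ** p)"
    by (intro linear_compose_add matrix_mult.bounded_linear_right [THEN bounded_linear.linear]
        matrix_mult.bounded_linear_left [THEN bounded_linear.linear])
  then show ?thesis
    unfolding anticommutant_def by (rule linear_subspace_kernel)
qed

text \<open>For the diagonal matrix \<open>mat quat_i\<close> the condition is entrywise, and a
  quaternion anticommutes with \<open>quat_i\<close> exactly when its components along 1 and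
  \<open>quat_i\<close> vanish. The two remaining components are packed into a complex number, so
  that the dimension can be read off from complex matrices.\<close>

lemma anticommutant_quat_i:
  "anticommutant (mat quat_i) =
    range (\<lambda>z :: complex ^ 'n ^ 'n. \<chi> i j. Quat 0 0 (Re (z $ i $ j)) (Im (z $ i $ j)))"
proof -
  have left: "(mat quat_i ** h) $ i $ j = quat_i * h $ i $ j"
    and right: "(h ** mat quat_i) $ i $ j = h $ i $ j * quat_i" for h :: "quat ^ 'n ^ 'n" and i j
    by (simp_all add: matrix_matrix_mult_def mat_def if_distrib [of "\<lambda>x. x * y" for y]
        if_distrib [of "\<lambda>x. y * x" for y] cong: if_cong)
  have "h \<in> anticommutant (mat quat_i) \<longleftrightarrow> (\<forall>i j. qRe (h $ i $ j) = 0 \<and> qI (h $ i $ j) = 0)"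
    for h :: "quat ^ 'n ^ 'n"
    by (auto simp: anticommutant_def vec_eq_iff left right quat_eq_iff)
  moreover have "h \<in> range (\<lambda>z :: complex ^ 'n ^ 'n. \<chi> i j. Quat 0 0 (Re (z $ i $ j)) (Im (z $ i $ j)))"
    if "\<forall>i j. qRe (h $ i $ j) = 0 \<and> qI (h $ i $ j) = 0" for h :: "quat ^ 'n ^ 'n"
    using that by (intro range_eqI [where x = "\<chi> i j. Complex (qJ (h $ i $ j)) (qK (h $ i $ j))"])
      (simp add: vec_eq_iff quat_eq_iff)
  ultimately show ?thesis
    by (intro equalityI subsetI) auto
qed

lemma dim_anticommutant_quat_i: "dim (anticommutant (mat quat_i :: quat ^ 'n ^ 'n)) = 2 * CARD('n)\<^sup>2"
proof -
  let ?L = "\<lambda>z :: complex ^ 'n ^ 'n. \<chi> i j. Quat 0 0 (Re (z $ i $ j)) (Im (z $ i $ j))"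
  have "linear ?L"
    by (rule linearI) (simp_all add: vec_eq_iff quat_eq_iff)
  moreover have "inj ?L"
    by (rule injI) (simp add: vec_eq_iff quat_eq_iff complex_eq_iff)
  ultimately have "dim (range ?L) = DIM(complex ^ 'n ^ 'n)"
    using dim_image_eq [of ?L UNIV] by simp
  then show ?thesis
    by (simp add: anticommutant_quat_i power2_eq_square)
qed

text \<open>Conjugation by \<open>a\<close> is a linear automorphism carrying
  \<open>mat quat_i\<close> to \<open>p\<close>, hence one anticommutant onto the other.\<close>

lemma dim_anticommutant_sqrt_neg_one:
  fixes p :: "quat ^ 'n ^ 'n"
  assumes "p \<in> sqrts_neg_one"
  shows "dim (anticommutant p) = 2 * CARD('n)\<^sup>2"
proof -
  obtain a :: "quat ^ 'n ^ 'n" where a: "invertible a" and p: "p = a ** mat quat_i ** matrix_inv a"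
    using assms unfolding sqrts_neg_one_eq_image by blast
  let ?b = "matrix_inv a"
  let ?c = "\<lambda>h. a ** h ** ?b"
  have ab: "a ** ?b = mat 1" "?b ** a = mat 1"
    by (simp_all add: matrix_inv_mult a)
  have cancel: "x ** a ** ?b = x" "x ** ?b ** a = x" for x
    by (simp_all add: ab flip: matrix_mul_assoc)
  have lin: "linear ?c"
    by (intro bounded_linear.linear bounded_linear_compose [OF matrix_mult.bounded_linear_left]
        matrix_mult.bounded_linear_right)
  have "inj ?c"
  proof (rule injI)
    fix x y
    assume "?c x = ?c y"
    then have "?b ** ?c x ** a = ?b ** ?c y ** a"
      by simp
    then show "x = y"
      by (simp add: matrix_mul_assoc ab cancel)
  qed
  have conj: "p ** ?c h + ?c h ** p = ?c (mat quat_i ** h + h ** mat quat_i)" for h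
    by (simp add: p matrix_mul_assoc cancel matrix_mult.add_left matrix_mult.add_right)
  have zero: "?c x = 0 \<longleftrightarrow> x = 0" for x
    using \<open>inj ?c\<close> lin linear_injective_0 linear_0 by metis
  have "anticommutant p = ?c ` anticommutant (mat quat_i)"
  proof (intro equalityI subsetI)
    fix h
    assume "h \<in> anticommutant p"
    moreover have h: "h = ?c (?b ** h ** a)"
      by (simp add: matrix_mul_assoc ab cancel)
    ultimately have "?b ** h ** a \<in> anticommutant (mat quat_i)"
      using conj [of "?b ** h ** a"] zero unfolding anticommutant_def by simp
    with h show "h \<in> ?c ` anticommutant (mat quat_i)"
      by blast
  next
    fix h
    assume "h \<in> ?c ` anticommutant (mat quat_i)"
    then show "h \<in> anticommutant p"
      by (auto simp: anticommutant_def conj)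
  qed
  then show ?thesis
    using dim_image_eq [OF lin, of "anticommutant (mat quat_i)"] \<open>inj ?c\<close>
    by (metis dim_anticommutant_quat_i inj_on_subset subset_UNIV)
qed

text \<open>The chart at \<open>p\<close> is the Cayley transform \<open>f \<mapsto> (1 + p f) (1 - p f)\<^sup>-\<^sup>1\<close>, written as
  \<open>2 (1 - p f)\<^sup>-\<^sup>1 - 1\<close>. Its inverse \<open>h \<mapsto> p (1 - h) (1 + h)\<^sup>-\<^sup>1\<close> equals
  \<open>(1 + h) p (1 + h)\<^sup>-\<^sup>1\<close> when \<open>h\<close> anticommutes with \<open>p\<close>.\<close>

lemma submanifold_sqrts_neg_one:
  "submanifold (2 * CARD('n)\<^sup>2) (sqrts_neg_one :: (quat ^ 'n ^ 'n) set)"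
  unfolding submanifold_def
proof
  fix p :: "quat ^ 'n ^ 'n"
  assume p: "p \<in> sqrts_neg_one"
  then have pp: "p ** p = - mat 1"
    by (simp add: sqrts_neg_one_def)
  have ppx: "p ** (p ** x) = - x" for x :: "quat ^ 'n ^ 'n"
    by (simp add: matrix_mul_assoc pp matrix_mult.minus_left)
  define U where "U = {f. invertible (mat 1 - p ** f)}"
  define W where "W = {h :: quat ^ 'n ^ 'n. invertible (mat 1 + h)}"
  define \<phi> where "\<phi> f = 2 *\<^sub>R matrix_inv (mat 1 - p ** f) - mat 1" for f
  define \<psi> where "\<psi> h = p ** (2 *\<^sub>R matrix_inv (mat 1 + h) - mat 1)" for h
  have "continuous_on UNIV (\<lambda>f. mat 1 - p ** f)"
    by (intro continuous_intros matrix_mult.continuous_on)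
  then have U: "open U"
    using open_vimage [OF open_invertible] by (auto simp: U_def vimage_def)
  have "continuous_on UNIV (\<lambda>h :: quat ^ 'n ^ 'n. mat 1 + h)"
    by (intro continuous_intros)
  then have W: "open W"
    using open_vimage [OF open_invertible] by (auto simp: W_def vimage_def)
  \<comment> \<open>By \<open>p p = -1\<close> the factor \<open>p\<close> in \<open>\<psi>\<close>
    cancels. Hence each map inverts, up to the factor 2, the very matrix inverted by the
    other.\<close>
  have one_minus: "mat 1 - p ** \<psi> h = 2 *\<^sub>R matrix_inv (mat 1 + h)" for h
    by (simp add: \<psi>_def ppx)
  have one_plus: "mat 1 + \<phi> f = 2 *\<^sub>R matrix_inv (mat 1 - p ** f)" for f
    by (simp add: \<phi>_def)
  have \<psi>: "\<psi> h \<in> U" "\<phi> (\<psi> h) = h" if "h \<in> W" for h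
    using that matrix_inv_scaleR_matrix_inv [of "mat 1 + h"] unfolding \<phi>_def one_minus U_def W_def
    by (simp_all add: one_minus)
  have \<phi>: "\<phi> f \<in> W" "\<psi> (\<phi> f) = f" if "f \<in> U" for f
    using that matrix_inv_scaleR_matrix_inv [of "mat 1 - p ** f"] unfolding \<psi>_def one_plus U_def W_def
    by (simp_all add: one_plus matrix_mult.minus_right ppx)
  have "smooth_on U \<phi>"
    unfolding smooth_on_def \<phi>_def
    by (intro allI C_diff_on_diff U C_diff_on_bounded_linear [OF U bounded_linear_scaleR_right]
        C_diff_on_matrix_inv C_diff_on_const C_diff_on_ident
        C_diff_on_bounded_linear [OF U matrix_mult.bounded_linear_right]) (simp add: U_def)
  moreover have "smooth_on W \<psi>"
    unfolding smooth_on_def \<psi>_def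
    by (intro allI C_diff_on_bounded_linear [OF W matrix_mult.bounded_linear_right]
        C_diff_on_diff W C_diff_on_bounded_linear [OF W bounded_linear_scaleR_right]
        C_diff_on_matrix_inv C_diff_on_add C_diff_on_const C_diff_on_ident) (simp add: W_def)
  moreover have "\<phi> ` U = W" "\<psi> ` W = U"
    using \<phi> \<psi> by (force simp: image_iff)+
  ultimately have "diffeomorphism U W \<phi> \<psi>"
    using U W \<phi> \<psi> by (simp add: diffeomorphism_def)
  \<comment> \<open>Here \<open>mat 1 - p ** p\<close> is twice the unit matrix.\<close>
  moreover have "p \<in> U"
  proof -
    have "(2 *\<^sub>R mat 1) ** ((1/2) *\<^sub>R mat 1) = (mat 1 :: quat ^ 'n ^ 'n)"
      "((1/2) *\<^sub>R mat 1) ** (2 *\<^sub>R mat 1) = (mat 1 :: quat ^ 'n ^ 'n)"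
      by (simp_all add: matrix_mult.scaleR_left)
    then have "invertible (2 *\<^sub>R mat 1 :: quat ^ 'n ^ 'n)"
      unfolding invertible_def by blast
    then show ?thesis
      by (simp add: U_def pp scaleR_2)
  qed
  moreover have "\<phi> ` (sqrts_neg_one \<inter> U) = anticommutant p \<inter> W"
  proof (intro equalityI subsetI)
    fix h
    assume "h \<in> \<phi> ` (sqrts_neg_one \<inter> U)"
    then obtain f where f: "f ** f = - mat 1" "f \<in> U" "h = \<phi> f"
      by (auto simp: sqrts_neg_one_def)
    define a where "a = mat 1 - p ** f"
    define b where "b = matrix_inv a"
    have inv: "invertible a"
      using f by (simp add: U_def a_def)
    have ab: "a ** b = mat 1" "b ** a = mat 1"
      by (simp_all add: b_def matrix_inv_mult inv)
    have ffx: "f ** (f ** x) = - x" for x :: "quat ^ 'n ^ 'n"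
      by (simp add: matrix_mul_assoc f matrix_mult.minus_left)
    \<comment> \<open>Both sides expand to \<open>2 p + f - p f p\<close>, by
      \<open>p p = f f = -1\<close>. Multiplying by \<open>b\<close> from both sides gives
      \<open>p = p b + b p\<close>, which says that \<open>h = 2 b - 1\<close> anticommutes with
      \<open>p\<close>.\<close>
    have "a ** p ** a = a ** p + p ** a"
      by (simp add: a_def matrix_mult.diff_left matrix_mult.diff_right ppx ffx f pp
          matrix_mult.minus_left matrix_mult.minus_right flip: matrix_mul_assoc)
    then have "b ** (a ** p ** a) ** b = b ** (a ** p + p ** a) ** b"
      by simp
    also have "\<dots> = (b ** a) ** p ** b + b ** p ** (a ** b)"
      by (simp only: matrix_mult.add_left matrix_mult.add_right matrix_mul_assoc)
    finally have "p = p ** b + b ** p"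
      by (simp add: ab matrix_mul_assoc) (simp add: ab flip: matrix_mul_assoc)
    then have "p ** b + b ** p = p"
      by simp
    moreover have "p ** h + h ** p = 2 *\<^sub>R (p ** b + b ** p) - 2 *\<^sub>R p"
      by (simp add: f \<phi>_def a_def [symmetric] b_def [symmetric] matrix_mult.diff_left
          matrix_mult.diff_right matrix_mult.scaleR_left matrix_mult.scaleR_right scaleR_add_right
          scaleR_2 [of p])
    ultimately show "h \<in> anticommutant p \<inter> W"
      using \<phi> f by (simp add: anticommutant_def)
  next
    fix h
    assume h: "h \<in> anticommutant p \<inter> W"
    define c where "c = matrix_inv (mat 1 + h)"
    have c: "c ** (mat 1 + h) = mat 1" "(mat 1 + h) ** c = mat 1"
      using h by (simp_all add: W_def c_def matrix_inv_mult)
    have "h ** p = - (p ** h)"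
      using h by (simp add: anticommutant_def eq_neg_iff_add_eq_0 add.commute)
    then have comm: "p ** (mat 1 - h) = (mat 1 + h) ** p"
      by (simp add: matrix_mult.diff_right matrix_mult.add_left)
    have "2 *\<^sub>R c - mat 1 = 2 *\<^sub>R c - (mat 1 + h) ** c"
      by (simp add: c)
    also have "\<dots> = (mat 1 - h) ** c"
      by (simp add: matrix_mult.diff_left matrix_mult.add_left scaleR_2)
    finally have "\<psi> h = p ** ((mat 1 - h) ** c)"
      by (simp add: \<psi>_def c_def)
    then have \<psi>h: "\<psi> h = (mat 1 + h) ** p ** c"
      by (simp add: matrix_mul_assoc comm)
    have "\<psi> h ** \<psi> h = (mat 1 + h) ** p ** (c ** (mat 1 + h)) ** p ** c"
      unfolding \<psi>h by (simp only: matrix_mul_assoc)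
    also have "\<dots> = (mat 1 + h) ** (p ** p) ** c"
      by (simp only: c matrix_mul_rid matrix_mul_assoc)
    also have "\<dots> = - mat 1"
      by (simp only: pp c matrix_mul_rid matrix_mult.minus_left matrix_mult.minus_right)
    finally have "\<psi> h \<in> sqrts_neg_one"
      by (simp add: sqrts_neg_one_def)
    moreover have "\<psi> h \<in> U" "\<phi> (\<psi> h) = h"
      using h \<psi> by simp_all
    ultimately show "h \<in> \<phi> ` (sqrts_neg_one \<inter> U)"
      by (metis IntI imageI)
  qed
  ultimately show "\<exists>U W \<phi> \<psi> V. p \<in> U \<and> diffeomorphism U W \<phi> \<psi> \<and>
      subspace (V :: (quat ^ 'n ^ 'n) set) \<and> dim V = 2 * CARD('n)\<^sup>2 \<and> \<phi> ` (sqrts_neg_one \<inter> U) = V \<inter> W"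
    using subspace_anticommutant [of p] dim_anticommutant_sqrt_neg_one [OF p]
    by blast
qed

theorem mainTheorem3:
  shows "(\<forall>f :: quat ^ 'n ^ 'n. f \<in> sqrts_neg_one \<longrightarrow> conjugate f (mat quat_i)) \<and>
    (sqrts_neg_one :: (quat ^ 'n ^ 'n) set) = conjugacy_class (mat quat_i) \<and>
    connected (sqrts_neg_one :: (quat ^ 'n ^ 'n) set) \<and>
    submanifold (2 * CARD('n) ^ 2) (sqrts_neg_one :: (quat ^ 'n ^ 'n) set) \<and>
    real (2 * CARD('n) ^ 2) = real DIM(quat ^ 'n ^ 'n) / 2 \<and>
    (\<forall>f :: quat ^ 'n ^ 'n. f \<in> sqrts_neg_one \<longrightarrow> Scal f = 0)"
proof (intro conjI allI impI)
  show "real (2 * CARD('n) ^ 2) = real DIM(quat ^ 'n ^ 'n) / 2"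
    by (simp add: power2_eq_square)
qed (simp_all only: sqrt_neg_one_conjugate connected_sqrts_neg_one submanifold_sqrts_neg_one
    Scal_sqrt_neg_one flip: sqrts_neg_one_eq_class)

end
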